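(* Let $N$ be a positive integer and let $d,k$ be integers with $1\le k\le d$. Suppose that $\vec{c}_1=[c_{1,0},\dots,c_{1,d}],\dots,\vec{c}_k=[c_{k,0},\dots,c_{k,d}]$ are linearly independent geometric progressions modulo $N$, all with the same ratio $m$ modulo $N$, such that $\gcd(c_{1,0},N)=1$. Let $L\subseteq\mathbb{Z}^{d+1}$ be the lattice with basis $(\vec{c}_1,\dots,\vec{c}_k)$ and $S=\mathrm{diag}(1,s,\dots,s^d)$ for a real number $s>0$. Then the lattice $L^\perp_S$ is $(d-k+1)$-dimensional and $$\det L^\perp_S\le s^{\frac{d(d-k+1)}{2}}\cdot N^{1-k}\cdot\prod_{i=1}^{k}\|\vec{c}_i\|_{2,s^{-1}}.$$
   Context: A geometric progression (GP) of length $\ell$ and ratio $r$ modulo $N$, where $r\in\mathbb{Z}/N\mathbb{Z}$, is an integer vector $[c_0,\dots,c_{\ell-1}]$ with $c_i\equiv c_0 r^i\pmod N$ for $0\le i<\ell$. For $\vec{x}=(x_0,\dots,x_d)\in\mathbb{R}^{d+1}$ and real $t>0$, $\|\vec{x}\|_{2,t}=t^{-d/2}\left(\sum_{i=0}^{d}(x_i t^i)^2\right)^{1/2}$; thus $\|\vec{x}\|_{2,s^{-1}}=s^{d/2}\left(\sum_{i=0}^d x_i^2 s^{-2i}\right)^{1/2}$. For a lattice $\Lambda\subseteq\mathbb{Z}^n$, $E_\Lambda$ is its $\mathbb{Q}$-span in $\mathbb{Q}^n$ and $\Lambda^\perp=\mathbb{Z}^n\cap E_\Lambda^\perp$ (standard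 inner product). For $T\in\mathrm{GL}_n(\mathbb{R})$, $\Gamma_T=\{\vec{x}T:\vec{x}\in\Gamma\}$ (row vectors) and $L^\perp_S=(L^\perp)_S$. The determinant of a lattice with basis matrix $C$ is $\sqrt{\det(CC^t)}$. *)

theory Defs
  imports
    Complex_Main
    "HOL-Number_Theory.Cong"
    "Jordan_Normal_Form.DL_Rank"
begin

definition geometric_progression :: "nat \<Rightarrow> int \<Rightarrow> nat \<Rightarrow> int vec \<Rightarrow> bool" where
  "geometric_progression N r l c \<longleftrightarrow>
     c \<in> carrier_vec l \<and> (\<forall>i<l. [c $ i = c $ 0 * r ^ i] (mod int N))"

text \<open>The degree \<open>d\<close> in the norm is \<open>dim_vec x - 1\<close>.\<close>

definition norm2 :: "real \<Rightarrow> real vec \<Rightarrow> real" where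
  "norm2 t x = t powr (- (real (dim_vec x) - 1) / 2) * sqrt (\<Sum>i<dim_vec x. (x $ i * t ^ i)\<^sup>2)"

text \<open>The coefficient ring is the type of the entries; for integer vectors, linear independence
  over the integers is the same as over the rationals or the reals.\<close>

definition lin_indpt_list :: "nat \<Rightarrow> 'a :: comm_ring_1 vec list \<Rightarrow> bool" where
  "lin_indpt_list n bs \<longleftrightarrow> set bs \<subseteq> carrier_vec n \<and> distinct bs \<and>
     LinearCombinations.module.lin_indpt class_ring (module_vec TYPE('a) n) (set bs)"

definition lattice_basis :: "nat \<Rightarrow> 'a :: comm_ring_1 vec list \<Rightarrow> 'a vec set \<Rightarrow> bool" where
  "lattice_basis n bs \<Lambda> \<longleftrightarrow> lin_indpt_list n bs \<and> \<Lambda> = vec_module.lattice_of n bs"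

definition lattice_of_dim :: "nat \<Rightarrow> nat \<Rightarrow> real vec set \<Rightarrow> bool" where
  "lattice_of_dim n r \<Lambda> \<longleftrightarrow> (\<exists>bs. lattice_basis n bs \<Lambda> \<and> length bs = r)"

definition lattice_det :: "nat \<Rightarrow> real vec set \<Rightarrow> real" where
  "lattice_det n \<Lambda> = (THE D. \<exists>bs. lattice_basis n bs \<Lambda> \<and>
     D = sqrt (det (mat_of_rows n bs * transpose_mat (mat_of_rows n bs))))"

definition rat_span :: "nat \<Rightarrow> int vec set \<Rightarrow> rat vec set" where
  "rat_span n \<Lambda> =
     LinearCombinations.module.span class_ring (module_vec TYPE(rat) n) (map_vec rat_of_int ` \<Lambda>)"

definition lattice_perp :: "nat \<Rightarrow> int vec set \<Rightarrow> int vec set" where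
  "lattice_perp n \<Lambda> =
     {x \<in> carrier_vec n. map_vec rat_of_int x \<in> vec_module.orthogonal_complement n (rat_span n \<Lambda>)}"

text \<open>The row vector \<open>x T\<close> is the column vector \<open>T\<^sup>T x\<close>.\<close>

definition lattice_transform :: "real mat \<Rightarrow> int vec set \<Rightarrow> real vec set" where
  "lattice_transform T \<Gamma> = (\<lambda>x. transpose_mat T *\<^sub>v map_vec real_of_int x) ` \<Gamma>"


text \<open>Dimension and determinant do not depend on the basis.\<close>

lemma lin_indpt_list_left_cancel:
  fixes bs :: "'a :: field vec list"
  assumes li: "lin_indpt_list n bs" and A: "A \<in> carrier_mat r (length bs)"
    and eq: "A * mat_of_rows n bs = mat_of_rows n bs" and r: "r = length bs"
  shows "A = 1\<^sub>m r"
proof -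
  let ?B = "mat_of_rows n bs"
  interpret vec_space "TYPE('a)" n .
  have bs: "set bs \<subseteq> carrier_vec n" "distinct bs" "lin_indpt (set bs)"
    using li unfolding lin_indpt_list_def by auto
  have cols: "cols (transpose_mat ?B) = bs" using bs(1) by simp
  have kernel: "v = 0\<^sub>v r" if v: "v \<in> carrier_vec r" "transpose_mat ?B *\<^sub>v v = 0\<^sub>v n" for v
  proof (rule ccontr)
    assume "v \<noteq> 0\<^sub>v r"
    with v r have "lin_dep (set (cols (transpose_mat ?B)))"
      by (intro lin_depI[of "transpose_mat ?B" r v]) (auto simp: cols bs(1,2))
    with bs(3) cols show False by simp
  qed
  define E where "E = A - 1\<^sub>m r"
  have E: "E \<in> carrier_mat r r" and B: "?B \<in> carrier_mat r n"
    using A r by (auto simp: E_def)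
  have "E * ?B = A * ?B - 1\<^sub>m r * ?B"
    unfolding E_def using A B r by (intro minus_mult_distrib_mat[of _ r r]) auto
  also have "\<dots> = 0\<^sub>m r n" using eq B by auto
  finally have EB: "E * ?B = 0\<^sub>m r n" .
  have "E = 0\<^sub>m r r"
  proof (rule eq_rowI)
    fix i assume "i < dim_row (0\<^sub>m r r :: 'a mat)"
    then have i: "i < r" by simp
    have "transpose_mat ?B *\<^sub>v row E i = 0\<^sub>v n"
    proof (rule eq_vecI)
      fix j assume "j < dim_vec (0\<^sub>v n :: 'a vec)"
      then have j: "j < n" by simp
      have "(transpose_mat ?B *\<^sub>v row E i) $ j = col ?B j \<bullet> row E i" using j B by simp
      also have "\<dots> = row E i \<bullet> col ?B j"
        by (rule comm_scalar_prod[of _ r]) (use E B i j in auto)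
      also have "\<dots> = (E * ?B) $$ (i, j)" using E B i j by simp
      finally show "(transpose_mat ?B *\<^sub>v row E i) $ j = (0\<^sub>v n :: 'a vec) $ j"
        using EB i j by simp
    qed (use B in auto)
    then have "row E i = 0\<^sub>v r" using kernel[of "row E i"] E i by auto
    then show "row E i = row (0\<^sub>m r r) i" using i by simp
  qed (use E in auto)
  then show ?thesis
    using A r unfolding E_def
    by (intro eq_matI) (auto simp: mat_eq_iff)
qed

lemma lattice_basis_change:
  fixes bs cs :: "real vec list"
  assumes bs: "lattice_basis n bs \<Lambda>" and cs: "lattice_basis n cs \<Lambda>"
  obtains U :: "int mat" where "U \<in> carrier_mat (length bs) (length cs)"
    "mat_of_rows n bs = map_mat of_int U * mat_of_rows n cs"
proof -
  interpret vec_space "TYPE(real)" n .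
  have b: "set bs \<subseteq> carrier_vec n" "\<Lambda> = lattice_of bs"
    and c: "set cs \<subseteq> carrier_vec n" "\<Lambda> = lattice_of cs"
    using bs cs unfolding lattice_basis_def lin_indpt_list_def by auto
  have "\<exists>u. bs ! i = sumlist (map (\<lambda>j. of_int (u j) \<cdot>\<^sub>v cs ! j) [0..<length cs])"
    if "i < length bs" for i
  proof -
    have "bs ! i \<in> lattice_of bs" by (rule basis_in_latticeI) (use b that in auto)
    then have "bs ! i \<in> lattice_of cs" using b(2) c(2) by simp
    then show ?thesis by (rule in_latticeE) blast
  qed
  then obtain u where u: "\<And>i. i < length bs \<Longrightarrow>
      bs ! i = sumlist (map (\<lambda>j. of_int (u i j) \<cdot>\<^sub>v cs ! j) [0..<length cs])"
    by metis
  define U where "U = mat (length bs) (length cs) (\<lambda>(i, j). u i j)"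
  have "mat_of_rows n bs = map_mat of_int U * mat_of_rows n cs"
  proof (rule eq_matI)
    fix i j
    assume "i < dim_row (map_mat of_int U * mat_of_rows n cs)"
      "j < dim_col (map_mat of_int U * mat_of_rows n cs)"
    then have i: "i < length bs" and j: "j < n" by (auto simp: U_def)
    have "mat_of_rows n bs $$ (i, j) = bs ! i $ j" using i j by (simp add: mat_of_rows_index)
    also have "\<dots> = (\<Sum>l = 0..<length cs. of_int (u i l) * cs ! l $ j)"
    proof -
      have *: "\<And>l. l < length cs \<Longrightarrow> cs ! l \<in> carrier_vec n" using c(1) by auto
      then have "\<And>l. l < length cs \<Longrightarrow> dim_vec (cs ! l) = n" by (metis carrier_vecD)
      with sumlist_nth[of "map (\<lambda>l. of_int (u i l) \<cdot>\<^sub>v cs ! l) [0..<length cs]" j]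
      show ?thesis using u[OF i] * j by (auto intro!: sum.cong)
    qed
    also have "\<dots> = (map_mat of_int U * mat_of_rows n cs) $$ (i, j)"
      using i j by (simp add: U_def scalar_prod_def mat_of_rows_index)
    finally show "mat_of_rows n bs $$ (i, j) = (map_mat of_int U * mat_of_rows n cs) $$ (i, j)" .
  qed (auto simp: U_def)
  then show thesis by (intro that[of U]) (auto simp: U_def)
qed

lemma trace_mult_comm:
  fixes A B :: "'a :: comm_ring_1 mat"
  assumes "A \<in> carrier_mat k l" "B \<in> carrier_mat l k"
  shows "(\<Sum>i<k. (A * B) $$ (i, i)) = (\<Sum>j<l. (B * A) $$ (j, j))"
proof -
  have "(\<Sum>i<k. (A * B) $$ (i, i)) = (\<Sum>i<k. \<Sum>j<l. A $$ (i, j) * B $$ (j, i))"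
    using assms by (auto simp: scalar_prod_def atLeast0LessThan intro!: sum.cong)
  also have "\<dots> = (\<Sum>j<l. \<Sum>i<k. B $$ (j, i) * A $$ (i, j))"
    by (subst sum.swap) (simp add: mult.commute)
  also have "\<dots> = (\<Sum>j<l. (B * A) $$ (j, j))"
    using assms by (auto simp: scalar_prod_def atLeast0LessThan intro!: sum.cong)
  finally show ?thesis .
qed

lemma lattice_basis_unique:
  fixes bs cs :: "real vec list"
  assumes bs: "lattice_basis n bs \<Lambda>" and cs: "lattice_basis n cs \<Lambda>"
  shows "length bs = length cs"
    and "det (mat_of_rows n bs * transpose_mat (mat_of_rows n bs)) =
      det (mat_of_rows n cs * transpose_mat (mat_of_rows n cs))"
proof -
  let ?B = "mat_of_rows n bs" and ?C = "mat_of_rows n cs"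
  let ?k = "length bs" and ?l = "length cs"
  obtain U where U: "U \<in> carrier_mat ?k ?l" "?B = map_mat of_int U * ?C"
    using lattice_basis_change[OF bs cs] .
  obtain V where V: "V \<in> carrier_mat ?l ?k" "?C = map_mat of_int V * ?B"
    using lattice_basis_change[OF cs bs] .
  let ?U = "map_mat real_of_int U" and ?V = "map_mat real_of_int V"
  have carr: "?U \<in> carrier_mat ?k ?l" "?V \<in> carrier_mat ?l ?k" using U V by auto
  have B: "?B \<in> carrier_mat ?k n" and C: "?C \<in> carrier_mat ?l n" by auto
  have "(?U * ?V) * ?B = ?B"
    unfolding assoc_mult_mat[OF carr B] V(2)[symmetric] U(2)[symmetric] ..
  then have UV: "?U * ?V = 1\<^sub>m ?k"
    using bs carr by (intro lin_indpt_list_left_cancel[of n bs]) (auto simp: lattice_basis_def)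
  have "(?V * ?U) * ?C = ?C"
    unfolding assoc_mult_mat[OF carr(2,1) C] U(2)[symmetric] V(2)[symmetric] ..
  then have VU: "?V * ?U = 1\<^sub>m ?l"
    using cs carr by (intro lin_indpt_list_left_cancel[of n cs]) (auto simp: lattice_basis_def)
  show len: "?k = ?l"
    using trace_mult_comm[OF carr] by (simp add: UV VU)
  have "det ?U * det ?V = 1"
    using det_mult[of ?U ?k ?V] UV carr len by simp
  then have "real_of_int (det U * det V) = 1"
    by (simp add: of_int_hom.hom_det)
  then have "det U * det V = 1"
    using of_int_eq_1_iff by blast
  then have "det U = 1 \<or> det U = - 1"
    using zmult_eq_1_iff by blast
  then have sq: "det ?U * det ?U = 1" by (auto simp: of_int_hom.hom_det)
  have U': "?U \<in> carrier_mat ?k ?k" and C': "?C \<in> carrier_mat ?k n" using carr C len by auto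
  have "?B * transpose_mat ?B = (?U * ?C) * (transpose_mat ?C * transpose_mat ?U)"
    using U(2) transpose_mult[OF U' C'] by simp
  also have "\<dots> = ?U * (?C * transpose_mat ?C) * transpose_mat ?U"
  proof -
    have Ct: "transpose_mat ?C \<in> carrier_mat n ?k" and Ut: "transpose_mat ?U \<in> carrier_mat ?k ?k"
      using U' C' by auto
    have CC: "?C * transpose_mat ?C \<in> carrier_mat ?k ?k" using mult_carrier_mat[OF C' Ct] .
    show ?thesis
      unfolding assoc_mult_mat[OF U' C' mult_carrier_mat[OF Ct Ut]] assoc_mult_mat[OF U' CC Ut]
        assoc_mult_mat[OF C' Ct Ut] ..
  qed
  finally have "det (?B * transpose_mat ?B) = det ?U * det (?C * transpose_mat ?C) * det ?U"
  proof -
    have CC: "?C * transpose_mat ?C \<in> carrier_mat ?k ?k" using C' by auto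
    assume "?B * transpose_mat ?B = ?U * (?C * transpose_mat ?C) * transpose_mat ?U"
    then show ?thesis
      using det_mult[OF mult_carrier_mat[OF U' CC], of "transpose_mat ?U"] det_mult[OF U' CC]
        det_transpose[OF U'] U' by simp
  qed
  then show "det (?B * transpose_mat ?B) = det (?C * transpose_mat ?C)"
    using sq by (simp add: algebra_simps)
qed

lemma lattice_det_eq:
  assumes "lattice_basis n bs \<Lambda>"
  shows "lattice_det n \<Lambda> = sqrt (det (mat_of_rows n bs * transpose_mat (mat_of_rows n bs)))"
  unfolding lattice_det_def
  using assms by (intro the_equality) (auto dest: lattice_basis_unique(2)[OF assms])

lemma lattice_of_dim_unique:
  assumes "lattice_of_dim n r \<Lambda>" "lattice_of_dim n r' \<Lambda>"
  shows "r = r'"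
  using assms unfolding lattice_of_dim_def by (auto dest: lattice_basis_unique(1))

end

theory Submission
  imports Defs "Jordan_Normal_Form.Matrix_Kernel"
begin

text \<open>
  Let \<open>C\<close> be the \<open>k \<times> n\<close> matrix of the progressions. Euclid's algorithm on the rows of \<open>C\<^sup>T\<close> gives
  a unimodular matrix \<open>[P; B]\<close> (\<open>P\<close> stacked on \<open>B\<close>) such that \<open>C B\<^sup>T = 0\<close>; the rows of \<open>B\<close> are
  then a basis of \<open>L\<^sup>\<bottom>\<close>, and \<open>\<bar>det (C P\<^sup>T)\<bar>\<close> is the index of \<open>L\<close> in its saturation. The rows of
  \<open>C S\<^sup>-\<^sup>1\<close> are orthogonal to those of \<open>B S\<close>, and evaluating the determinant of the matrix formed by
  both in two ways expresses \<open>det L\<^sup>\<bottom>\<^sub>S\<close> as \<open>det S\<close> times the volume spanned by the rows of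
  \<open>C S\<^sup>-\<^sup>1\<close>, divided by that index. Hadamard's inequality bounds the volume by the product of the
  norms. Modulo \<open>N\<close> all progressions are multiples of the first one, so \<open>N\<^sup>k\<^sup>-\<^sup>1\<close> divides the
  nonzero number \<open>det (C P\<^sup>T)\<close>.
\<close>

subsection \<open>Stacked matrices\<close>

lemma dim_append_rows:
  "dim_row (A @\<^sub>r B) = dim_row A + dim_row B" "dim_col (A @\<^sub>r B) = dim_col A"
  by (simp_all add: append_rows_def)

lemma index_append_rows:
  assumes "A \<in> carrier_mat nr1 n" "B \<in> carrier_mat nr2 n" "i < nr1 + nr2" "j < n"
  shows "(A @\<^sub>r B) $$ (i, j) = (if i < nr1 then A $$ (i, j) else B $$ (i - nr1, j))"
  using assms by (auto simp: append_rows_def)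

lemma row_append_rows:
  assumes "A \<in> carrier_mat nr1 n" "B \<in> carrier_mat nr2 n" "i < nr1 + nr2"
  shows "row (A @\<^sub>r B) i = (if i < nr1 then row A i else row B (i - nr1))"
  using assms by (intro eq_vecI) (auto simp: dim_append_rows index_append_rows)

lemma append_rows_mult:
  assumes "A \<in> carrier_mat nr1 n" "B \<in> carrier_mat nr2 n" "D \<in> carrier_mat n nc"
  shows "(A @\<^sub>r B) * D = (A * D) @\<^sub>r (B * D)"
proof (rule eq_matI)
  fix i j assume "i < dim_row ((A * D) @\<^sub>r (B * D))" "j < dim_col ((A * D) @\<^sub>r (B * D))"
  then have "i < nr1 + nr2" "j < nc"
    using assms by (auto simp: dim_append_rows)
  then show "((A @\<^sub>r B) * D) $$ (i, j) = ((A * D) @\<^sub>r (B * D)) $$ (i, j)"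
    using assms index_append_rows[of "A * D" nr1 nc "B * D" nr2 i j]
    by (simp add: dim_append_rows row_append_rows[of A nr1 n B nr2])
qed (use assms in \<open>auto simp: dim_append_rows\<close>)

lemma append_rows_mult_transpose:
  fixes A :: "'a :: comm_semiring_1 mat"
  assumes "A \<in> carrier_mat nr1 n" "B \<in> carrier_mat nr2 n"
    and "C \<in> carrier_mat nc1 n" "D \<in> carrier_mat nc2 n"
  shows "(A @\<^sub>r B) * (C @\<^sub>r D)\<^sup>T = four_block_mat (A * C\<^sup>T) (A * D\<^sup>T) (B * C\<^sup>T) (B * D\<^sup>T)"
  by (rule eq_matI)
    (use assms in \<open>auto simp: dim_append_rows row_append_rows[of A nr1 n B nr2]
      row_append_rows[of C nc1 n D nc2]\<close>)

lemma transpose_append_rows_mult_append_vec: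
  fixes A :: "'a :: comm_ring_1 mat"
  assumes A: "A \<in> carrier_mat nr1 n" and B: "B \<in> carrier_mat nr2 n"
    and "x \<in> carrier_vec nr1" "y \<in> carrier_vec nr2"
  shows "(A @\<^sub>r B)\<^sup>T *\<^sub>v (x @\<^sub>v y) = A\<^sup>T *\<^sub>v x + B\<^sup>T *\<^sub>v y"
proof -
  have "(A @\<^sub>r B)\<^sup>T = four_block_mat (A\<^sup>T) (B\<^sup>T) (0\<^sub>m 0 nr1) (0\<^sub>m 0 nr2)"
    using A B unfolding append_rows_def
    by (subst transpose_four_block_mat[of _ nr1 n _ 0 _ nr2]) auto
  then show ?thesis
    using assms by (intro eq_vecI) (auto simp: four_block_mat_mult_vec[of _ n nr1 _ nr2 _ 0])
qed

lemma rows_append_rows: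
  assumes "A \<in> carrier_mat nr1 n" "B \<in> carrier_mat nr2 n"
  shows "rows (A @\<^sub>r B) = rows A @ rows B"
  using assms
  by (intro nth_equalityI) (auto simp: append_rows_def nth_append row_four_block_mat)

lemma append_rows_split:
  assumes "M \<in> carrier_mat (k + l) n"
  obtains A B where "A \<in> carrier_mat k n" "B \<in> carrier_mat l n" "M = A @\<^sub>r B"
proof -
  obtain A Z B Z' where blocks: "split_block M k n = (A, Z, B, Z')"
    by (metis prod_cases4)
  note split = split_block[OF blocks, of l 0]
  have "Z = 0\<^sub>m k 0" "Z' = 0\<^sub>m l 0"
    using split(2,4) assms by auto
  then show thesis
    using that[of A B] split assms by (auto simp: append_rows_def)
qed

subsection \<open>Unimodular matrices\<close>

definition unimodular_mat :: "nat \<Rightarrow> 'a :: comm_ring_1 mat \<Rightarrow> bool" where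
  "unimodular_mat n U \<longleftrightarrow> U \<in> carrier_mat n n \<and> det U dvd 1"

lemma unimodular_mat_carrier: "unimodular_mat n U \<Longrightarrow> U \<in> carrier_mat n n"
  by (simp add: unimodular_mat_def)

lemma unimodular_mat_one: "unimodular_mat n (1\<^sub>m n)"
  by (simp add: unimodular_mat_def)

lemma unimodular_mat_mult:
  assumes "unimodular_mat n U" "unimodular_mat n V"
  shows "unimodular_mat n (U * V)"
  using assms unfolding unimodular_mat_def by (auto simp: det_mult)

lemma unimodular_mat_addrow: "i \<noteq> j \<Longrightarrow> unimodular_mat n (addrow_mat n a i j)"
  by (simp add: unimodular_mat_def det_addrow_mat)

lemma unimodular_mat_swaprows:
  assumes "i < n" "j < n"
  shows "unimodular_mat n (swaprows_mat n i j)"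
proof (cases "i = j")
  case True
  have "swaprows_mat n j j = 1\<^sub>m n"
    by (rule eq_matI) auto
  then show ?thesis
    using True by (metis unimodular_mat_one)
qed (use assms in \<open>simp add: unimodular_mat_def det_swaprows_mat\<close>)

lemma unimodular_mat_four_block_one:
  fixes U :: "'a :: idom mat"
  assumes "unimodular_mat n U"
  shows "unimodular_mat (Suc n) (four_block_mat (1\<^sub>m 1) (0\<^sub>m 1 n) (0\<^sub>m n 1) U)"
  using assms det_four_block_mat_lower_left_zero[of "1\<^sub>m 1" 1 "0\<^sub>m 1 n" n "0\<^sub>m n 1" U]
  by (auto simp: unimodular_mat_def)

lemma unimodular_mat_inverse:
  assumes "unimodular_mat n U"
  obtains V where "V \<in> carrier_mat n n" "U * V = 1\<^sub>m n" "V * U = 1\<^sub>m n"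
proof -
  have U: "U \<in> carrier_mat n n"
    using assms by (rule unimodular_mat_carrier)
  obtain u where u: "1 = det U * u"
    using assms by (auto simp: unimodular_mat_def)
  have "u \<cdot>\<^sub>m (det U \<cdot>\<^sub>m 1\<^sub>m n) = 1\<^sub>m n"
    using u by (intro eq_matI) (auto simp: mult.commute)
  then show thesis
    using that[of "u \<cdot>\<^sub>m adj_mat U"] adj_mat[OF U] U
    by (simp add: mult_smult_distrib mult_smult_assoc_mat[of _ n n])
qed

lemma unimodular_mat_det_square:
  fixes U :: "int mat"
  assumes "unimodular_mat n U"
  shows "(det U)\<^sup>2 = 1"
  using assms by (auto simp: unimodular_mat_def power2_eq_1_iff abs_eq_iff)

lemma addrow_mod_column_size_less:
  fixes A :: "'a :: euclidean_ring mat"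
  assumes A: "A \<in> carrier_mat n nc" and c: "c < nc" and ij: "i < n" "j < n" "i \<noteq> j"
    and nonzero: "A $$ (i, c) \<noteq> 0"
    and size: "euclidean_size (A $$ (i, c)) \<le> euclidean_size (A $$ (j, c))"
  defines "E \<equiv> addrow_mat n (- (A $$ (j, c) div A $$ (i, c))) j i"
  shows "(\<Sum>r<n. euclidean_size ((E * A) $$ (r, c))) < (\<Sum>r<n. euclidean_size (A $$ (r, c)))"
proof -
  have entries: "(E * A) $$ (r, c) =
      (if r = j then A $$ (j, c) mod A $$ (i, c) else A $$ (r, c))" if "r < n" for r
    using that A c ij unfolding E_def addrow_mat[OF A ij(1), symmetric]
    by (simp add: minus_div_mult_eq_mod[symmetric])
  have "euclidean_size (A $$ (j, c) mod A $$ (i, c)) < euclidean_size (A $$ (j, c))"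
    using mod_size_less[OF nonzero] size by (rule less_le_trans)
  then show ?thesis
    using ij(2) by (intro sum_strict_mono_ex1) (auto simp: entries)
qed

text \<open>Euclid's algorithm on the entries of the column, with their total size as termination
  measure.\<close>

lemma unimodular_clear_column:
  fixes A :: "'a :: euclidean_ring mat"
  assumes "A \<in> carrier_mat n nc" "c < nc" "p < n"
  shows "\<exists>U. unimodular_mat n U \<and> (\<forall>i<n. i \<noteq> p \<longrightarrow> (U * A) $$ (i, c) = 0)"
  using assms
proof (induction "\<Sum>i<n. euclidean_size (A $$ (i, c))" arbitrary: A rule: less_induct)
  case less
  note A = \<open>A \<in> carrier_mat n nc\<close>
  show ?case
  proof (cases "\<exists>i<n. \<exists>j<n. i \<noteq> j \<and> A $$ (i, c) \<noteq> 0 \<and> A $$ (j, c) \<noteq> 0")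
    case True
    then obtain i j where ij: "i < n" "j < n" "i \<noteq> j" "A $$ (i, c) \<noteq> 0"
      and size: "euclidean_size (A $$ (i, c)) \<le> euclidean_size (A $$ (j, c))"
      by (metis nle_le)
    let ?E = "addrow_mat n (- (A $$ (j, c) div A $$ (i, c))) j i"
    have E: "?E \<in> carrier_mat n n"
      by simp
    obtain U where U: "unimodular_mat n U"
      and clear: "\<forall>r<n. r \<noteq> p \<longrightarrow> (U * (?E * A)) $$ (r, c) = 0"
      using less.hyps[OF addrow_mod_column_size_less[OF A \<open>c < nc\<close> ij size]
          mult_carrier_mat[OF E A] \<open>c < nc\<close> \<open>p < n\<close>] by blast
    have "U * ?E * A = U * (?E * A)"
      by (rule assoc_mult_mat[OF unimodular_mat_carrier[OF U] E A])
    then show ?thesis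
      using clear unimodular_mat_mult[OF U unimodular_mat_addrow] ij(3) by metis
  next
    case False
    then obtain r where r: "r < n" "\<And>i. i < n \<Longrightarrow> i \<noteq> r \<Longrightarrow> A $$ (i, c) = 0"
      using \<open>p < n\<close> by metis
    have "swaprows_mat n p r * A = swaprows p r A"
      using swaprows_mat[OF A \<open>p < n\<close> r(1)] by simp
    then have "(swaprows_mat n p r * A) $$ (i, c) = 0" if "i < n" "i \<noteq> p" for i
      using that A \<open>c < nc\<close> \<open>p < n\<close> r by simp
    then show ?thesis
      using unimodular_mat_swaprows[OF \<open>p < n\<close> r(1)] by blast
  qed
qed

lemma unimodular_clear_first_column:
  fixes A :: "'a :: euclidean_ring mat"
  assumes A: "A \<in> carrier_mat (Suc n) (Suc k)"
  obtains U a r A' where "unimodular_mat (Suc n) U" "a \<in> carrier_mat 1 1" "r \<in> carrier_mat 1 k"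
    "A' \<in> carrier_mat n k" "U * A = four_block_mat a r (0\<^sub>m n 1) A'"
proof -
  obtain U where U: "unimodular_mat (Suc n) U"
    and clear: "\<And>i. i < n \<Longrightarrow> (U * A) $$ (Suc i, 0) = 0"
    using unimodular_clear_column[OF A, of 0 0] by auto
  have UA: "U * A \<in> carrier_mat (1 + n) (1 + k)"
    using unimodular_mat_carrier[OF U] A by simp
  obtain a r z A' where blocks: "split_block (U * A) 1 1 = (a, r, z, A')"
    by (metis prod_cases4)
  note split = split_block[OF blocks carrier_matD[OF UA]]
  have "z = 0\<^sub>m n 1"
  proof (rule eq_matI)
    fix i j assume "i < dim_row (0\<^sub>m n 1 :: 'a mat)" "j < dim_col (0\<^sub>m n 1 :: 'a mat)"
    then show "z $$ (i, j) = 0\<^sub>m n 1 $$ (i, j)"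
      using clear[of i] split(1-4) unfolding split(5) by simp
  qed (use split in auto)
  then show thesis
    using that U split by blast
qed

lemma unimodular_upper_triangularize:
  fixes A :: "'a :: euclidean_ring mat"
  assumes "A \<in> carrier_mat n k"
  shows "\<exists>U. unimodular_mat n U \<and> (\<forall>i<n. \<forall>j<k. j < i \<longrightarrow> (U * A) $$ (i, j) = 0)"
  using assms
proof (induction k arbitrary: n A)
  case 0
  then show ?case
    using unimodular_mat_one by auto
next
  case (Suc k)
  show ?case
  proof (cases n)
    case 0
    then show ?thesis
      using unimodular_mat_one by auto
  next
    case n: (Suc n')
    have A: "A \<in> carrier_mat (Suc n') (Suc k)"
      using Suc.prems n by simp
    obtain U a r A' where U: "unimodular_mat (Suc n') U" and a: "a \<in> carrier_mat 1 1"
      and r: "r \<in> carrier_mat 1 k" and A': "A' \<in> carrier_mat n' k"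
      and UA: "U * A = four_block_mat a r (0\<^sub>m n' 1) A'"
      using unimodular_clear_first_column[OF A] .
    obtain W where W: "unimodular_mat n' W"
      and triangular: "\<And>i j. i < n' \<Longrightarrow> j < k \<Longrightarrow> j < i \<Longrightarrow> (W * A') $$ (i, j) = 0"
      using Suc.IH[OF A'] by blast
    have W_carrier: "W \<in> carrier_mat n' n'"
      using W by (rule unimodular_mat_carrier)
    let ?W = "four_block_mat (1\<^sub>m 1) (0\<^sub>m 1 n') (0\<^sub>m n' 1) W"
    have "?W * U * A = ?W * (U * A)"
      using W_carrier unimodular_mat_carrier[OF U] A by (intro assoc_mult_mat) auto
    also have "\<dots> = four_block_mat a r (0\<^sub>m n' 1) (W * A')"
      unfolding UA using a r A' W_carrier by (subst mult_four_block_mat) auto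
    finally have WUA: "?W * U * A = four_block_mat a r (0\<^sub>m n' 1) (W * A')" .
    have "(?W * U * A) $$ (i, j) = 0" if "i < n" "j < Suc k" "j < i" for i j
      unfolding WUA using that triangular[of "i - 1" "j - 1"] n a r A' W_carrier by auto
    then show ?thesis
      using unimodular_mat_mult[OF unimodular_mat_four_block_one[OF W] U] n by blast
  qed
qed

subsection \<open>Gram determinants\<close>

abbreviation gram_mat :: "'a :: semiring_0 mat \<Rightarrow> 'a mat" where
  "gram_mat M \<equiv> M * M\<^sup>T"

lemma scalar_prod_self_nonneg: "0 \<le> (v :: real vec) \<bullet> v"
  using conjugate_square_ge_0_vec[of v] by simp

lemma scalar_prod_self_eq_0_iff:
  fixes v :: "real vec"
  assumes "v \<in> carrier_vec n"
  shows "v \<bullet> v = 0 \<longleftrightarrow> v = 0\<^sub>v n"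
  using conjugate_square_eq_0_vec[OF assms] by simp

text \<open>A row that depends on the previous ones yields the zero vector; the junk value \<open>x / 0 = 0\<close>
  then makes its coefficients vanish.\<close>

fun gram_schmidt_row :: "real mat \<Rightarrow> nat \<Rightarrow> real vec" where
  "gram_schmidt_row M i = row M i - vec (dim_col M) (\<lambda>j. \<Sum>l<i.
     (row M i \<bullet> gram_schmidt_row M l) / (gram_schmidt_row M l \<bullet> gram_schmidt_row M l) *
     gram_schmidt_row M l $ j)"

declare gram_schmidt_row.simps [simp del]

definition gram_schmidt_coeff :: "real mat \<Rightarrow> nat \<Rightarrow> nat \<Rightarrow> real" where
  "gram_schmidt_coeff M i l =
     (row M i \<bullet> gram_schmidt_row M l) / (gram_schmidt_row M l \<bullet> gram_schmidt_row M l)"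

definition gram_schmidt_projection :: "real mat \<Rightarrow> nat \<Rightarrow> real vec" where
  "gram_schmidt_projection M i =
     vec (dim_col M) (\<lambda>j. \<Sum>l<i. gram_schmidt_coeff M i l * gram_schmidt_row M l $ j)"

lemma gram_schmidt_projection_carrier: "gram_schmidt_projection M i \<in> carrier_vec (dim_col M)"
  by (simp add: gram_schmidt_projection_def)

lemma gram_schmidt_row_eq: "gram_schmidt_row M i = row M i - gram_schmidt_projection M i"
  by (subst gram_schmidt_row.simps) (simp add: gram_schmidt_projection_def gram_schmidt_coeff_def)

lemma gram_schmidt_row_carrier: "gram_schmidt_row M i \<in> carrier_vec (dim_col M)"
  using carrier_vecD[OF gram_schmidt_projection_carrier[of M i]]
  by (intro carrier_vecI) (simp add: gram_schmidt_row_eq)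

lemma row_eq_gram_schmidt: "row M i = gram_schmidt_projection M i + gram_schmidt_row M i"
  unfolding gram_schmidt_row_eq by (rule eq_vecI) (simp_all add: gram_schmidt_projection_def)

lemma gram_schmidt_projection_scalar_prod:
  assumes "v \<in> carrier_vec (dim_col M)"
  shows "gram_schmidt_projection M i \<bullet> v =
    (\<Sum>l<i. gram_schmidt_coeff M i l * (gram_schmidt_row M l \<bullet> v))"
proof -
  let ?c = "gram_schmidt_coeff M i" and ?g = "gram_schmidt_row M"
  have "gram_schmidt_projection M i \<bullet> v = (\<Sum>j<dim_col M. \<Sum>l<i. ?c l * ?g l $ j * v $ j)"
    using assms
    by (simp add: gram_schmidt_projection_def scalar_prod_def atLeast0LessThan sum_distrib_right)
  also have "\<dots> = (\<Sum>l<i. \<Sum>j<dim_col M. ?c l * ?g l $ j * v $ j)"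
    by (rule sum.swap)
  also have "\<dots> = (\<Sum>l<i. ?c l * (?g l \<bullet> v))"
    using assms by (simp add: scalar_prod_def atLeast0LessThan sum_distrib_left mult.assoc)
  finally show ?thesis .
qed

lemma gram_schmidt_orthogonal_less:
  "l < i \<Longrightarrow> gram_schmidt_row M i \<bullet> gram_schmidt_row M l = 0"
proof (induction i arbitrary: l rule: less_induct)
  case (less i)
  let ?g = "gram_schmidt_row M"
  note carrier = gram_schmidt_row_carrier[of M]
  have "?g r \<bullet> ?g l = 0" if "r < i" "r \<noteq> l" for r
  proof (cases "l < r")
    case True
    then show ?thesis
      by (rule less.IH[OF \<open>r < i\<close>])
  next
    case False
    then have "?g l \<bullet> ?g r = 0"
      using \<open>r \<noteq> l\<close> by (intro less.IH[OF \<open>l < i\<close>]) simp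
    then show ?thesis
      by (rule trans[OF comm_scalar_prod[OF carrier carrier]])
  qed
  then have "gram_schmidt_projection M i \<bullet> ?g l =
      (\<Sum>r<i. if r = l then gram_schmidt_coeff M i l * (?g l \<bullet> ?g l) else 0)"
    unfolding gram_schmidt_projection_scalar_prod[OF carrier] by (intro sum.cong) auto
  also have "\<dots> = gram_schmidt_coeff M i l * (?g l \<bullet> ?g l)"
    using \<open>l < i\<close> by simp
  also have "\<dots> = row M i \<bullet> ?g l"
    using scalar_prod_self_eq_0_iff[OF carrier, of l]
    by (cases "?g l \<bullet> ?g l = 0") (auto simp: gram_schmidt_coeff_def)
  finally show ?case
    unfolding gram_schmidt_row_eq[of M i]
    by (simp add: minus_scalar_prod_distrib[OF _ gram_schmidt_projection_carrier carrier])
qed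

lemma gram_schmidt_orthogonal:
  assumes "i \<noteq> l"
  shows "gram_schmidt_row M i \<bullet> gram_schmidt_row M l = 0"
proof (cases "l < i")
  case False
  have "gram_schmidt_row M i \<bullet> gram_schmidt_row M l = gram_schmidt_row M l \<bullet> gram_schmidt_row M i"
    by (rule comm_scalar_prod[OF gram_schmidt_row_carrier gram_schmidt_row_carrier])
  also have "\<dots> = 0"
    using False assms by (intro gram_schmidt_orthogonal_less) simp
  finally show ?thesis .
qed (rule gram_schmidt_orthogonal_less)

lemma gram_schmidt_row_norm_le:
  "gram_schmidt_row M i \<bullet> gram_schmidt_row M i \<le> row M i \<bullet> row M i"
proof -
  let ?p = "gram_schmidt_projection M i" and ?g = "gram_schmidt_row M i"
  note p = gram_schmidt_projection_carrier[of M i] and g = gram_schmidt_row_carrier[of M i]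
  have "?p \<bullet> ?g = 0"
    unfolding gram_schmidt_projection_scalar_prod[OF g] by (simp add: gram_schmidt_orthogonal)
  moreover have "?g \<bullet> ?p = ?p \<bullet> ?g"
    by (rule comm_scalar_prod[OF g p])
  ultimately have "row M i \<bullet> row M i = ?p \<bullet> ?p + ?g \<bullet> ?g"
    unfolding row_eq_gram_schmidt[of M i] using p g
    by (simp add: add_scalar_prod_distrib[of _ "dim_col M"]
        scalar_prod_add_distrib[of _ "dim_col M"])
  then show ?thesis
    using scalar_prod_self_nonneg[of ?p] by simp
qed

lemma gram_schmidt_factorization:
  assumes M: "M \<in> carrier_mat k n"
  obtains E G where "E \<in> carrier_mat k k" "det E = 1" "G \<in> carrier_mat k n" "M = E * G"
    "\<And>i. i < k \<Longrightarrow> row G i = gram_schmidt_row M i"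
proof -
  define E where
    "E = mat k k (\<lambda>(i, l). if l < i then gram_schmidt_coeff M i l else if l = i then 1 else 0)"
  define G where "G = mat k n (\<lambda>(i, j). gram_schmidt_row M i $ j)"
  have E: "E \<in> carrier_mat k k" and G: "G \<in> carrier_mat k n"
    by (simp_all add: E_def G_def)
  have rows: "row G i = gram_schmidt_row M i" if "i < k" for i
    using that M gram_schmidt_row_carrier[of M i] by (intro eq_vecI) (auto simp: G_def)
  have M_eq: "M = E * G"
  proof (rule eq_matI)
    fix i j assume "i < dim_row (E * G)" "j < dim_col (E * G)"
    then have i: "i < k" and j: "j < n"
      using E G by auto
    have "M $$ (i, j) = row M i $ j"
      using M i j by simp
    also have "\<dots> = (\<Sum>l<i. gram_schmidt_coeff M i l * gram_schmidt_row M l $ j) +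
        gram_schmidt_row M i $ j"
      using M j gram_schmidt_row_carrier[of M i]
      unfolding row_eq_gram_schmidt[of M i] by (simp add: gram_schmidt_projection_def)
    also have "\<dots> = (\<Sum>l<Suc i. E $$ (i, l) * G $$ (l, j))"
      using i j by (simp add: E_def G_def)
    also have "\<dots> = (\<Sum>l<k. E $$ (i, l) * G $$ (l, j))"
      using i by (intro sum.mono_neutral_left) (auto simp: E_def)
    also have "\<dots> = (E * G) $$ (i, j)"
      using E G i j by (simp add: scalar_prod_def atLeast0LessThan)
    finally show "M $$ (i, j) = (E * G) $$ (i, j)" .
  qed (use E G M in auto)
  have "det E = (\<Prod>i = 0..<k. E $$ (i, i))"
    using E det_lower_triangular[OF _ E] by (simp add: prod_list_diag_prod E_def)
  then have "det E = 1"
    by (simp add: E_def)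
  then show thesis
    using that E G M_eq rows by blast
qed

lemma det_mat_diag: "det (mat_diag n f) = (\<Prod>i<n. f i)"
proof -
  have "det (mat_diag n f) = prod_list (diag_mat (mat_diag n f))"
    by (rule det_lower_triangular[OF _ mat_diag_dim]) (simp add: mat_diag_def)
  then show ?thesis
    by (simp add: prod_list_diag_prod mat_diag_def atLeast0LessThan)
qed

lemma gram_mat_mult:
  fixes A :: "'a :: comm_semiring_0 mat"
  assumes A: "A \<in> carrier_mat m k" and M: "M \<in> carrier_mat k n"
  shows "gram_mat (A * M) = A * gram_mat M * A\<^sup>T"
proof -
  have Mt: "M\<^sup>T \<in> carrier_mat n k" and At: "A\<^sup>T \<in> carrier_mat k m"
    using A M by auto
  show ?thesis
    unfolding transpose_mult[OF A M] assoc_mult_mat[OF A M mult_carrier_mat[OF Mt At]]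
      assoc_mult_mat[OF A mult_carrier_mat[OF M Mt] At] assoc_mult_mat[OF M Mt At] ..
qed

lemma det_gram_mat_mult:
  fixes A :: "'a :: comm_ring_1 mat"
  assumes A: "A \<in> carrier_mat k k" and M: "M \<in> carrier_mat k n"
  shows "det (gram_mat (A * M)) = (det A)\<^sup>2 * det (gram_mat M)"
proof -
  have "det (A * gram_mat M * A\<^sup>T) = det A * det (gram_mat M) * det A"
    using A M by (simp add: det_mult[of _ k] det_transpose)
  then show ?thesis
    unfolding gram_mat_mult[OF A M] by (simp add: power2_eq_square)
qed

lemma det_gram_mat_eq_prod_gram_schmidt:
  assumes M: "M \<in> carrier_mat k n"
  shows "det (gram_mat M) = (\<Prod>i<k. gram_schmidt_row M i \<bullet> gram_schmidt_row M i)"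
proof -
  obtain E G where E: "E \<in> carrier_mat k k" "det E = 1" and G: "G \<in> carrier_mat k n"
    and M_eq: "M = E * G" and rows: "\<And>i. i < k \<Longrightarrow> row G i = gram_schmidt_row M i"
    using gram_schmidt_factorization[OF M] by blast
  have "gram_mat G = mat_diag k (\<lambda>i. gram_schmidt_row M i \<bullet> gram_schmidt_row M i)"
    using G by (intro eq_matI) (auto simp: rows mat_diag_def gram_schmidt_orthogonal)
  then show ?thesis
    using det_gram_mat_mult[OF E(1) G] E(2) unfolding M_eq[symmetric] by (simp add: det_mat_diag)
qed

theorem hadamard_inequality:
  fixes M :: "real mat"
  assumes "M \<in> carrier_mat k n"
  shows "det (gram_mat M) \<le> (\<Prod>i<k. row M i \<bullet> row M i)"
  unfolding det_gram_mat_eq_prod_gram_schmidt[OF assms]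
  by (rule prod_mono) (simp add: scalar_prod_self_nonneg gram_schmidt_row_norm_le)

lemma det_gram_mat_ne_0:
  fixes M :: "real mat"
  assumes M: "M \<in> carrier_mat k n"
    and kernel: "mat_kernel (M\<^sup>T) \<subseteq> {0\<^sub>v k}"
  shows "det (gram_mat M) \<noteq> 0"
proof
  have Mt: "M\<^sup>T \<in> carrier_mat n k"
    using M by simp
  assume "det (gram_mat M) = 0"
  then obtain x where x: "x \<in> carrier_vec k" "x \<noteq> 0\<^sub>v k" and "gram_mat M *\<^sub>v x = 0\<^sub>v k"
    using det_0_iff_vec_prod_zero[OF mult_carrier_mat[OF M Mt]] by blast
  then have Mx: "M *\<^sub>v (M\<^sup>T *\<^sub>v x) = 0\<^sub>v k"
    using assoc_mult_mat_vec[OF M Mt x(1)] by simp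
  have y: "M\<^sup>T *\<^sub>v x \<in> carrier_vec n"
    using Mt x(1) by simp
  have "(M\<^sup>T *\<^sub>v x) \<bullet> (M\<^sup>T *\<^sub>v x) = x \<bullet> (M *\<^sub>v (M\<^sup>T *\<^sub>v x))"
    by (rule transpose_vec_mult_scalar[OF M y x(1)])
  also have "\<dots> = 0"
    using Mx x(1) by simp
  finally have "M\<^sup>T *\<^sub>v x = 0\<^sub>v n"
    using scalar_prod_self_eq_0_iff[OF y] by blast
  then have "x = 0\<^sub>v k"
    using kernel mat_kernelI[OF Mt x(1)] by blast
  with x(2) show False ..
qed

subsection \<open>Orthogonal complements\<close>

lemma det_append_rows_orthogonal:
  fixes A D :: "'a :: idom mat"
  assumes A: "A \<in> carrier_mat k (k + l)" and D: "D \<in> carrier_mat l (k + l)"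
    and orthogonal: "A * D\<^sup>T = 0\<^sub>m k l"
  shows "(det (A @\<^sub>r D))\<^sup>2 = det (gram_mat A) * det (gram_mat D)"
proof -
  have AD: "A @\<^sub>r D \<in> carrier_mat (k + l) (k + l)"
    using A D by simp
  have "D * A\<^sup>T = (A * D\<^sup>T)\<^sup>T"
    using A D by (simp add: transpose_mult[of _ k "k + l"])
  then have "D * A\<^sup>T = 0\<^sub>m l k"
    by (simp add: orthogonal)
  then have "gram_mat (A @\<^sub>r D) =
      four_block_mat (gram_mat A) (0\<^sub>m k l) (0\<^sub>m l k) (gram_mat D)"
    unfolding append_rows_mult_transpose[OF A D A D] orthogonal by simp
  moreover have "det (gram_mat (A @\<^sub>r D)) = (det (A @\<^sub>r D))\<^sup>2"
    using AD by (simp add: det_mult[of _ "k + l"] det_transpose power2_eq_square)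
  ultimately show ?thesis
    using A D by (simp add: det_four_block_mat_lower_left_zero[of _ k _ l])
qed

lemma det_append_rows_triangular:
  fixes A P B T :: "'a :: idom mat"
  assumes A: "A \<in> carrier_mat k (k + l)" and P: "P \<in> carrier_mat k (k + l)"
    and B: "B \<in> carrier_mat l (k + l)" and T: "T \<in> carrier_mat (k + l) (k + l)"
    and orthogonal: "A * T\<^sup>T * B\<^sup>T = 0\<^sub>m k l"
  shows "det (A @\<^sub>r B * T) * det T * det (P @\<^sub>r B) = det (A * T\<^sup>T * P\<^sup>T) * det (gram_mat (B * T))"
proof -
  let ?n = "k + l" and ?D = "B * T"
  have Tt: "T\<^sup>T \<in> carrier_mat ?n ?n" and Bt: "B\<^sup>T \<in> carrier_mat ?n l" and D: "?D \<in> carrier_mat l ?n"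
    using T B by auto
  have "?D * T\<^sup>T * B\<^sup>T = gram_mat ?D"
    unfolding transpose_mult[OF B T] by (rule assoc_mult_mat[OF D Tt Bt])
  then have product: "(A @\<^sub>r ?D) * T\<^sup>T * (P @\<^sub>r B)\<^sup>T =
      four_block_mat (A * T\<^sup>T * P\<^sup>T) (0\<^sub>m k l) (?D * T\<^sup>T * P\<^sup>T) (gram_mat ?D)"
    unfolding append_rows_mult[OF A D Tt]
      append_rows_mult_transpose[OF mult_carrier_mat[OF A Tt] mult_carrier_mat[OF D Tt] P B]
      orthogonal by simp
  have "det (A @\<^sub>r ?D) * det T * det (P @\<^sub>r B) = det ((A @\<^sub>r ?D) * T\<^sup>T * (P @\<^sub>r B)\<^sup>T)"
    using A D T P B
    by (simp add: det_mult[of _ ?n] det_transpose[of _ ?n] mult_carrier_mat[of _ _ ?n])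
  also have "\<dots> = det (A * T\<^sup>T * P\<^sup>T) * det (gram_mat ?D)"
    unfolding product using A D Tt P by (intro det_four_block_mat_upper_right_zero) auto
  finally show ?thesis .
qed

text \<open>With \<open>A = C S\<^sup>T\<close> and \<open>D = B T\<close>, the rows of \<open>A\<close> are orthogonal to those of \<open>D\<close>, so both
  previous lemmas evaluate \<open>det [A; D]\<close>.\<close>

lemma det_gram_orthogonal_complement:
  fixes C P B T S :: "'a :: idom mat"
  assumes C: "C \<in> carrier_mat k (k + l)" and P: "P \<in> carrier_mat k (k + l)"
    and B: "B \<in> carrier_mat l (k + l)" and T: "T \<in> carrier_mat (k + l) (k + l)"
    and S: "S \<in> carrier_mat (k + l) (k + l)" and TS: "T * S = 1\<^sub>m (k + l)"
    and orthogonal: "C * B\<^sup>T = 0\<^sub>m k l"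
  defines "A \<equiv> C * S\<^sup>T" and "D \<equiv> B * T"
  assumes nondegenerate: "det (gram_mat D) \<noteq> 0"
  shows "(det (C * P\<^sup>T))\<^sup>2 * det (gram_mat D) = (det T)\<^sup>2 * (det (P @\<^sub>r B))\<^sup>2 * det (gram_mat A)"
proof -
  let ?n = "k + l"
  have A: "A \<in> carrier_mat k ?n" and D: "D \<in> carrier_mat l ?n"
    using C S B T by (auto simp: A_def D_def)
  have Tt: "T\<^sup>T \<in> carrier_mat ?n ?n" and St: "S\<^sup>T \<in> carrier_mat ?n ?n"
    and Bt: "B\<^sup>T \<in> carrier_mat ?n l"
    using T S B by auto
  have "S\<^sup>T * T\<^sup>T = 1\<^sub>m ?n"
    using transpose_mult[OF T S] TS by simp
  then have AT: "A * T\<^sup>T = C"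
    unfolding A_def assoc_mult_mat[OF C St Tt] using C by simp
  have "A * D\<^sup>T = 0\<^sub>m k l"
    unfolding D_def transpose_mult[OF B T] assoc_mult_mat[OF A Tt Bt, symmetric] AT
    by (rule orthogonal)
  then have gram: "(det (A @\<^sub>r D))\<^sup>2 = det (gram_mat A) * det (gram_mat D)"
    by (rule det_append_rows_orthogonal[OF A D])
  have "det (A @\<^sub>r D) * det T * det (P @\<^sub>r B) = det (C * P\<^sup>T) * det (gram_mat D)"
    using det_append_rows_triangular[OF A P B T] orthogonal unfolding AT D_def by simp
  then have "(det (C * P\<^sup>T))\<^sup>2 * (det (gram_mat D))\<^sup>2 =
      (det (A @\<^sub>r D))\<^sup>2 * (det T)\<^sup>2 * (det (P @\<^sub>r B))\<^sup>2"
    by (simp flip: power_mult_distrib)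
  then show ?thesis
    unfolding gram using nondegenerate by (simp add: power2_eq_square algebra_simps)
qed

subsection \<open>Lattices spanned by the rows of a matrix\<close>

abbreviation row_lattice :: "nat \<Rightarrow> 'a :: comm_ring_1 mat \<Rightarrow> 'a vec set" where
  "row_lattice n M \<equiv> vec_module.lattice_of n (rows M)"

lemma row_lattice_eq:
  fixes M :: "'a :: comm_ring_1 mat"
  assumes M: "M \<in> carrier_mat l n"
  shows "row_lattice n M = (\<lambda>y. M\<^sup>T *\<^sub>v map_vec of_int y) ` carrier_vec l"
proof -
  interpret vec_module "TYPE('a)" n .
  have combination: "sumlist (map (\<lambda>i. of_int (a i) \<cdot>\<^sub>v rows M ! i) [0..<length (rows M)]) =
      M\<^sup>T *\<^sub>v map_vec of_int (vec l a)" (is "?sum = ?prod") for a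
  proof (rule eq_vecI)
    fix j assume "j < dim_vec ?prod"
    then show "?sum $ j = ?prod $ j"
      using M by (subst sumlist_nth) (auto simp: scalar_prod_def mult.commute intro!: sum.cong)
  next
    have "dim_vec ?sum = n"
      by (rule sumlist_dim) (use M in auto)
    then show "dim_vec ?sum = dim_vec ?prod"
      using M by simp
  qed
  have "y \<in> range (vec l)" if "y \<in> carrier_vec l" for y :: "int vec"
    using that by (intro range_eqI[of _ _ "($) y"]) auto
  then have "carrier_vec l = range (vec l :: _ \<Rightarrow> int vec)"
    by auto
  then show ?thesis
    unfolding lattice_of_def combination by (simp add: image_image)
qed

lemma row_lattice_int_eq:
  fixes M :: "int mat"
  assumes "M \<in> carrier_mat l n"
  shows "row_lattice n M = (\<lambda>y. M\<^sup>T *\<^sub>v y) ` carrier_vec l"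
proof -
  have "map_vec of_int y = y" for y :: "int vec"
    by (intro eq_vecI) auto
  then show ?thesis
    using row_lattice_eq[OF assms] by simp
qed

lemma orthogonal_row_lattice_iff:
  fixes C :: "int mat"
  assumes C: "C \<in> carrier_mat k n" and x: "x \<in> carrier_vec n"
  shows "(\<forall>y\<in>row_lattice n C. x \<bullet> y = 0) \<longleftrightarrow> x \<in> mat_kernel C"
proof
  assume orthogonal: "\<forall>y\<in>row_lattice n C. x \<bullet> y = 0"
  have "row C i \<bullet> x = 0" if "i < k" for i
  proof -
    have "row C i \<in> row_lattice n C"
      by (rule vec_module.basis_in_latticeI) (use C that in \<open>auto simp: rows_def\<close>)
    then show ?thesis
      using orthogonal comm_scalar_prod[OF row_carrier_vec[OF that C] x] by simp
  qed
  then show "x \<in> mat_kernel C"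
    using C x by (intro mat_kernelI eq_vecI) auto
next
  assume "x \<in> mat_kernel C"
  then have Cx: "C *\<^sub>v x = 0\<^sub>v k"
    by (rule mat_kernelD[OF C])
  have "x \<bullet> (C\<^sup>T *\<^sub>v y) = 0" if y: "y \<in> carrier_vec k" for y
  proof -
    have "x \<bullet> (C\<^sup>T *\<^sub>v y) = (C\<^sup>T *\<^sub>v y) \<bullet> x"
      using C y by (intro comm_scalar_prod[OF x]) auto
    also have "\<dots> = y \<bullet> (C *\<^sub>v x)"
      by (rule transpose_vec_mult_scalar[OF C x y])
    finally show ?thesis
      using Cx y by simp
  qed
  then show "\<forall>y\<in>row_lattice n C. x \<bullet> y = 0"
    unfolding row_lattice_int_eq[OF C] by blast
qed

lemma lattice_perp_altdef:
  assumes "\<Lambda> \<subseteq> carrier_vec n"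
  shows "lattice_perp n \<Lambda> = {x \<in> carrier_vec n. \<forall>y\<in>\<Lambda>. x \<bullet> y = 0}"
proof -
  interpret vec_space "TYPE(rat)" n .
  let ?rat = "map_vec rat_of_int"
  have "?rat ` \<Lambda> \<subseteq> carrier_vec n"
    using assms by auto
  then have "x \<in> lattice_perp n \<Lambda> \<longleftrightarrow> x \<in> carrier_vec n \<and> (\<forall>y\<in>\<Lambda>. ?rat x \<bullet> ?rat y = 0)" for x
    unfolding lattice_perp_def rat_span_def
    by (simp only: in_orthogonal_complement_span) (simp add: orthogonal_complement_def)
  moreover have "?rat x \<bullet> ?rat y = rat_of_int (x \<bullet> y)" if "x \<in> carrier_vec n" "y \<in> \<Lambda>" for x y
    using that assms by (auto simp: scalar_prod_def)
  ultimately show ?thesis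
    by auto
qed

lemma lattice_perp_row_lattice:
  assumes C: "C \<in> carrier_mat k n"
  shows "lattice_perp n (row_lattice n C) = mat_kernel C"
proof -
  have "row_lattice n C \<subseteq> carrier_vec n"
    unfolding row_lattice_int_eq[OF C] using C by (auto intro!: mult_mat_vec_carrier[of _ n k])
  then show ?thesis
    using orthogonal_row_lattice_iff[OF C] mat_kernel_carrier[OF C]
    by (auto simp: lattice_perp_altdef)
qed

lemma lattice_transform_row_lattice:
  assumes B: "B \<in> carrier_mat l n" and T: "T \<in> carrier_mat n n"
  shows "lattice_transform T (row_lattice n B) = row_lattice n (map_mat real_of_int B * T)"
proof -
  let ?B = "map_mat real_of_int B"
  have Br: "?B \<in> carrier_mat l n" and Brt: "?B\<^sup>T \<in> carrier_mat n l"
    and Tt: "T\<^sup>T \<in> carrier_mat n n"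
    using B T by auto
  have "T\<^sup>T *\<^sub>v map_vec real_of_int (B\<^sup>T *\<^sub>v y) = (?B * T)\<^sup>T *\<^sub>v map_vec of_int y"
    if y: "y \<in> carrier_vec l" for y
  proof -
    have "map_vec real_of_int (B\<^sup>T *\<^sub>v y) = ?B\<^sup>T *\<^sub>v map_vec real_of_int y"
      using of_int_hom.mult_mat_vec_hom[of "B\<^sup>T" n l y] B y by (simp add: map_mat_transpose)
    then show ?thesis
      using assoc_mult_mat_vec[OF Tt Brt, of "map_vec real_of_int y"] y
      by (simp add: transpose_mult[OF Br T])
  qed
  then show ?thesis
    unfolding lattice_transform_def row_lattice_int_eq[OF B]
      row_lattice_eq[OF mult_carrier_mat[OF Br T]]
    by (simp add: image_image)
qed

lemma lin_indpt_list_kernel: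
  fixes bs :: "'a :: comm_ring_1 vec list"
  assumes "lin_indpt_list n bs"
  shows "mat_kernel (mat_of_cols n bs) \<subseteq> {0\<^sub>v (length bs)}"
proof
  interpret vec_module "TYPE('a)" n .
  have bs: "set bs \<subseteq> carrier_vec n" "distinct bs" "lin_indpt (set bs)"
    using assms unfolding lin_indpt_list_def by auto
  fix x assume "x \<in> mat_kernel (mat_of_cols n bs)"
  then have x: "x \<in> carrier_vec (length bs)" and zero: "mat_of_cols n bs *\<^sub>v x = 0\<^sub>v n"
    by (auto simp: mat_kernel_def)
  define f where "f v = (\<Sum>i = 0..<length bs. if v = bs ! i then x $ i else 0)" for v
  have "lincomb f (set bs) = 0\<^sub>v n"
    unfolding f_def using x bs(1) zero by (subst mat_of_cols_mult_as_finsum[symmetric]) auto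
  then have "f v = 0" if "v \<in> set bs" for v
    using bs(3) that unfolding lin_dep_def by blast
  moreover have "f (bs ! i) = x $ i" if "i < length bs" for i
  proof -
    have "f (bs ! i) = (\<Sum>j = 0..<length bs. if i = j then x $ j else 0)"
      unfolding f_def using bs(2) that by (intro sum.cong) (auto simp: nth_eq_iff_index_eq)
    then show ?thesis
      using that by simp
  qed
  ultimately have "x = 0\<^sub>v (length bs)"
    using x by (intro eq_vecI) (metis carrier_vecD index_zero_vec nth_mem)+
  then show "x \<in> {0\<^sub>v (length bs)}"
    by simp
qed

lemma mat_of_rows_rows_carrier:
  "M \<in> carrier_mat k n \<Longrightarrow> mat_of_rows n (rows M) = M"
  using mat_of_rows_rows[of M] by simp

lemma lin_indpt_rows_kernel:
  fixes M :: "'a :: comm_ring_1 mat"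
  assumes M: "M \<in> carrier_mat k n" and independent: "lin_indpt_list n (rows M)"
  shows "mat_kernel (M\<^sup>T) \<subseteq> {0\<^sub>v k}"
proof -
  have "mat_of_cols n (rows M) = M\<^sup>T"
    using transpose_mat_of_rows[of n "rows M"] by (simp add: mat_of_rows_rows_carrier[OF M])
  then show ?thesis
    using lin_indpt_list_kernel[OF independent] M by simp
qed

lemma lin_indpt_list_rows:
  fixes M :: "'a :: field mat"
  assumes M: "M \<in> carrier_mat n n" and "det M \<noteq> 0"
  shows "lin_indpt_list n (rows M)"
proof -
  interpret vec_space "TYPE('a)" n .
  have "distinct (rows M)"
    using assms det_identical_rows[OF M] by (auto simp: distinct_conv_nth)
  then show ?thesis
    using M det_not_0_imp_lin_indpt_rows[OF assms] rows_carrier[of M]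
    unfolding lin_indpt_list_def by auto
qed

lemma lin_indpt_list_appendD2:
  fixes bs cs :: "'a :: field vec list"
  assumes "lin_indpt_list n (bs @ cs)"
  shows "lin_indpt_list n cs"
proof -
  interpret vec_space "TYPE('a)" n .
  show ?thesis
    using assms subset_li_is_li[of "set (bs @ cs)" "set cs"] unfolding lin_indpt_list_def by auto
qed

subsection \<open>Completing the orthogonal complement to a unimodular matrix\<close>

abbreviation transformed_perp :: "nat \<Rightarrow> real mat \<Rightarrow> int mat \<Rightarrow> real vec set" where
  "transformed_perp n T C \<equiv> lattice_transform T (lattice_perp n (row_lattice n C))"

lemma map_mat_append_rows:
  assumes "dim_col A = dim_col B"
  shows "map_mat f (A @\<^sub>r B) = map_mat f A @\<^sub>r map_mat f B"
  using assms by (intro eq_matI) (auto simp: append_rows_def)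

lemma map_mat_of_int_mult_transpose:
  assumes "A \<in> carrier_mat k n" "B \<in> carrier_mat l n"
  shows "map_mat of_int A * (map_mat of_int B)\<^sup>T = map_mat of_int (A * B\<^sup>T)"
  unfolding map_mat_transpose
  by (rule of_int_hom.mat_hom_mult[symmetric]) (use assms in auto)

locale orthogonal_completion =
  fixes k l :: nat and C P B :: "int mat"
  assumes C: "C \<in> carrier_mat k (k + l)" and P: "P \<in> carrier_mat k (k + l)"
    and B: "B \<in> carrier_mat l (k + l)"
    and unimodular: "unimodular_mat (k + l) (P @\<^sub>r B)"
    and orthogonal: "C * B\<^sup>T = 0\<^sub>m k l"
    and independent: "lin_indpt_list (k + l) (rows C)"

lemma orthogonal_completion_exists:
  assumes C: "C \<in> carrier_mat k (k + l)" and independent: "lin_indpt_list (k + l) (rows C)"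
  obtains P B where "orthogonal_completion k l C P B"
proof -
  have Ct: "C\<^sup>T \<in> carrier_mat (k + l) k"
    using C by simp
  obtain U where U: "unimodular_mat (k + l) U"
    and triangular: "\<And>i j. i < k + l \<Longrightarrow> j < k \<Longrightarrow> j < i \<Longrightarrow> (U * C\<^sup>T) $$ (i, j) = 0"
    using unimodular_upper_triangularize[OF Ct] by blast
  obtain P B where P: "P \<in> carrier_mat k (k + l)" and B: "B \<in> carrier_mat l (k + l)"
    and U_eq: "U = P @\<^sub>r B"
    using append_rows_split[OF unimodular_mat_carrier[OF U]] .
  have UC: "U * C\<^sup>T = (P * C\<^sup>T) @\<^sub>r (B * C\<^sup>T)"
    unfolding U_eq by (rule append_rows_mult[OF P B Ct])
  have "B * C\<^sup>T = 0\<^sub>m l k"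
  proof (rule eq_matI)
    fix i j assume "i < dim_row (0\<^sub>m l k :: int mat)" "j < dim_col (0\<^sub>m l k :: int mat)"
    then show "(B * C\<^sup>T) $$ (i, j) = 0\<^sub>m l k $$ (i, j)"
      using triangular[of "k + i" j] unfolding UC
      by (simp add: index_append_rows[OF mult_carrier_mat[OF P Ct] mult_carrier_mat[OF B Ct]])
  qed (use B C in auto)
  then have "C * B\<^sup>T = 0\<^sub>m k l"
    using transpose_mult[OF B Ct] by simp
  then have "orthogonal_completion k l C P B"
    using C P B U independent unfolding U_eq by unfold_locales
  then show thesis
    by (rule that)
qed

context orthogonal_completion
begin

lemma transpose_carriers:
  "C\<^sup>T \<in> carrier_mat (k + l) k" "P\<^sup>T \<in> carrier_mat (k + l) k" "B\<^sup>T \<in> carrier_mat (k + l) l"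
  using C P B by auto

lemma det_mult_transpose_ne_0: "det (C * P\<^sup>T) \<noteq> 0"
proof
  note Ct = transpose_carriers(1) and Pt = transpose_carriers(2)
  assume "det (C * P\<^sup>T) = 0"
  moreover have "(C * P\<^sup>T)\<^sup>T = P * C\<^sup>T"
    using transpose_mult[OF C Pt] by simp
  ultimately have "det (P * C\<^sup>T) = 0"
    using det_transpose[OF mult_carrier_mat[OF C Pt]] by simp
  then obtain x where x: "x \<in> carrier_vec k" "x \<noteq> 0\<^sub>v k" and PCx: "(P * C\<^sup>T) *\<^sub>v x = 0\<^sub>v k"
    using det_0_iff_vec_prod_zero[OF mult_carrier_mat[OF P Ct]] by blast
  have "B * C\<^sup>T = 0\<^sub>m l k"
    using transpose_mult[OF C transpose_carriers(3)] orthogonal by simp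
  then have BCx: "(B * C\<^sup>T) *\<^sub>v x = 0\<^sub>v l"
    using x(1) by auto
  have Cx: "C\<^sup>T *\<^sub>v x \<in> carrier_vec (k + l)"
    using Ct x(1) by simp
  have "(P @\<^sub>r B) *\<^sub>v (C\<^sup>T *\<^sub>v x) = 0\<^sub>v k @\<^sub>v 0\<^sub>v l"
    unfolding mat_mult_append[OF P B Cx]
    using PCx BCx assoc_mult_mat_vec[OF P Ct x(1)] assoc_mult_mat_vec[OF B Ct x(1)] by simp
  also have "\<dots> = 0\<^sub>v (k + l)"
    by auto
  finally have "C\<^sup>T *\<^sub>v x = 0\<^sub>v (k + l)"
    using det_0_iff_vec_prod_zero[OF unimodular_mat_carrier[OF unimodular]] Cx
      unimodular_mat_det_square[OF unimodular] by (metis power_zero_numeral zero_neq_one)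
  then show False
    using lin_indpt_rows_kernel[OF C independent] mat_kernelI[OF Ct x(1)] x(2) by auto
qed

lemma carrier_vec_decomposition:
  assumes x: "x \<in> carrier_vec (k + l)"
  obtains u w where "u \<in> carrier_vec k" "w \<in> carrier_vec l" "x = P\<^sup>T *\<^sub>v u + B\<^sup>T *\<^sub>v w"
proof -
  have U: "P @\<^sub>r B \<in> carrier_mat (k + l) (k + l)"
    by (rule unimodular_mat_carrier[OF unimodular])
  obtain V where V: "V \<in> carrier_mat (k + l) (k + l)" and VU: "V * (P @\<^sub>r B) = 1\<^sub>m (k + l)"
    using unimodular_mat_inverse[OF unimodular] .
  have Ut: "(P @\<^sub>r B)\<^sup>T \<in> carrier_mat (k + l) (k + l)"
    and Vt: "V\<^sup>T \<in> carrier_mat (k + l) (k + l)"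
    using U V by auto
  define y where "y = V\<^sup>T *\<^sub>v x"
  have y: "y = vec_first y k @\<^sub>v vec_last y l"
    using Vt x unfolding y_def by (intro vec_first_last_append[symmetric]) simp
  have "(P @\<^sub>r B)\<^sup>T * V\<^sup>T = 1\<^sub>m (k + l)"
    using transpose_mult[OF V U] VU by simp
  then have "x = (P @\<^sub>r B)\<^sup>T *\<^sub>v y"
    unfolding y_def assoc_mult_mat_vec[OF Ut Vt x, symmetric] using x by simp
  also have "\<dots> = P\<^sup>T *\<^sub>v vec_first y k + B\<^sup>T *\<^sub>v vec_last y l"
    by (subst y, rule transpose_append_rows_mult_append_vec[OF P B]) simp_all
  finally show thesis
    by (intro that) simp_all
qed

lemma mat_kernel_eq_image: "mat_kernel C = (\<lambda>y. B\<^sup>T *\<^sub>v y) ` carrier_vec l"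
proof (intro equalityI subsetI)
  note Pt = transpose_carriers(2) and Bt = transpose_carriers(3)
  fix x assume "x \<in> mat_kernel C"
  then have x: "x \<in> carrier_vec (k + l)" "C *\<^sub>v x = 0\<^sub>v k"
    using mat_kernelD[OF C] by auto
  obtain u w where u: "u \<in> carrier_vec k" and w: "w \<in> carrier_vec l"
    and x_eq: "x = P\<^sup>T *\<^sub>v u + B\<^sup>T *\<^sub>v w"
    using carrier_vec_decomposition[OF x(1)] .
  have "C *\<^sub>v x = (C * P\<^sup>T) *\<^sub>v u + (C * B\<^sup>T) *\<^sub>v w"
    unfolding x_eq using C Pt Bt u w by (simp add: mult_add_distrib_mat_vec[of _ k "k + l"])
  also have "(C * B\<^sup>T) *\<^sub>v w = 0\<^sub>v k"
    unfolding orthogonal using w by auto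
  also have "(C * P\<^sup>T) *\<^sub>v u + 0\<^sub>v k = (C * P\<^sup>T) *\<^sub>v u"
    using C Pt u by (intro right_zero_vec mult_mat_vec_carrier[of _ k k]) auto
  finally have "(C * P\<^sup>T) *\<^sub>v u = 0\<^sub>v k"
    using x(2) by simp
  then have "u = 0\<^sub>v k"
    using det_0_iff_vec_prod_zero[OF mult_carrier_mat[OF C Pt]] det_mult_transpose_ne_0 u by blast
  then have "P\<^sup>T *\<^sub>v u = 0\<^sub>v (k + l)"
    using Pt by (intro eq_vecI) auto
  then have "x = B\<^sup>T *\<^sub>v w"
    unfolding x_eq using Bt w by simp
  then show "x \<in> (\<lambda>y. B\<^sup>T *\<^sub>v y) ` carrier_vec l"
    using w by blast
next
  note Bt = transpose_carriers(3)
  fix x assume "x \<in> (\<lambda>y. B\<^sup>T *\<^sub>v y) ` carrier_vec l"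
  then obtain y where y: "y \<in> carrier_vec l" and x_eq: "x = B\<^sup>T *\<^sub>v y"
    by blast
  have "C *\<^sub>v x = (C * B\<^sup>T) *\<^sub>v y"
    unfolding x_eq by (rule assoc_mult_mat_vec[OF C Bt y, symmetric])
  also have "\<dots> = 0\<^sub>v k"
    unfolding orthogonal using y by auto
  finally have "C *\<^sub>v x = 0\<^sub>v k" .
  then show "x \<in> mat_kernel C"
    using Bt y by (intro mat_kernelI[OF C]) (simp_all add: x_eq)
qed

lemma lattice_perp_eq_row_lattice:
  "lattice_perp (k + l) (row_lattice (k + l) C) = row_lattice (k + l) B"
  unfolding lattice_perp_row_lattice[OF C] mat_kernel_eq_image row_lattice_int_eq[OF B] ..

lemma lattice_basis_transform_perp:
  assumes T: "T \<in> carrier_mat (k + l) (k + l)" "det T \<noteq> 0"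
  shows "lattice_basis (k + l) (rows (map_mat real_of_int B * T)) (transformed_perp (k + l) T C)"
proof -
  let ?U = "map_mat real_of_int (P @\<^sub>r B)"
  let ?P = "map_mat real_of_int P" and ?B = "map_mat real_of_int B"
  have Pr: "?P \<in> carrier_mat k (k + l)" and Br: "?B \<in> carrier_mat l (k + l)"
    using P B by auto
  have U: "?U \<in> carrier_mat (k + l) (k + l)"
    using unimodular_mat_carrier[OF unimodular] by simp
  have "det (P @\<^sub>r B) \<noteq> 0"
    using unimodular_mat_det_square[OF unimodular] by auto
  then have "det (?U * T) \<noteq> 0"
    using T by (simp add: det_mult[OF U])
  then have "lin_indpt_list (k + l) (rows (?U * T))"
    using U T by (intro lin_indpt_list_rows) auto
  moreover have "?U = ?P @\<^sub>r ?B"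
    using P B by (intro map_mat_append_rows) simp
  then have "rows (?U * T) = rows (?P * T) @ rows (?B * T)"
    by (simp add: append_rows_mult[OF Pr Br T(1)]
        rows_append_rows[OF mult_carrier_mat[OF Pr T(1)] mult_carrier_mat[OF Br T(1)]])
  ultimately show ?thesis
    unfolding lattice_basis_def lattice_perp_eq_row_lattice lattice_transform_row_lattice[OF B T(1)]
    by (auto intro: lin_indpt_list_appendD2)
qed

theorem lattice_of_dim_transform_perp:
  assumes "T \<in> carrier_mat (k + l) (k + l)" "det T \<noteq> 0"
  shows "lattice_of_dim (k + l) l (transformed_perp (k + l) T C)"
  using lattice_basis_transform_perp[OF assms] B unfolding lattice_of_dim_def
  by (intro exI[of _ "rows (map_mat real_of_int B * T)"]) simp

theorem lattice_det_transform_perp: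
  assumes T: "T \<in> carrier_mat (k + l) (k + l)" and S: "S \<in> carrier_mat (k + l) (k + l)"
    and TS: "T * S = 1\<^sub>m (k + l)"
  defines "A \<equiv> map_mat real_of_int C * S\<^sup>T"
  shows "lattice_det (k + l) (transformed_perp (k + l) T C) =
    \<bar>det T\<bar> * sqrt (det (gram_mat A)) / \<bar>real_of_int (det (C * P\<^sup>T))\<bar>"
proof -
  let ?r = "map_mat real_of_int" and ?h = "real_of_int (det (C * P\<^sup>T))"
  have C': "?r C \<in> carrier_mat k (k + l)" and P': "?r P \<in> carrier_mat k (k + l)"
    and B': "?r B \<in> carrier_mat l (k + l)"
    using C P B by auto
  let ?D = "?r B * T"
  have D: "?D \<in> carrier_mat l (k + l)"
    using B' T by simp
  have "det T * det S = 1"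
    using det_mult[OF T S] TS by simp
  then have "det T \<noteq> 0"
    by auto
  note basis = lattice_basis_transform_perp[OF T this]
  have det_D: "det (gram_mat ?D) \<noteq> 0"
    using basis
    by (intro det_gram_mat_ne_0[OF D] lin_indpt_rows_kernel[OF D]) (simp add: lattice_basis_def)
  have "?r C * (?r B)\<^sup>T = ?r (0\<^sub>m k l)"
    unfolding map_mat_of_int_mult_transpose[OF C B] orthogonal ..
  also have "\<dots> = 0\<^sub>m k l"
    by (rule eq_matI) auto
  finally have orthogonal': "?r C * (?r B)\<^sup>T = 0\<^sub>m k l" .
  have "det (?r C * (?r P)\<^sup>T) = ?h"
    unfolding map_mat_of_int_mult_transpose[OF C P] by (rule of_int_hom.hom_det)
  moreover have "(det (?r P @\<^sub>r ?r B))\<^sup>2 = 1"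
    using unimodular_mat_det_square[OF unimodular] P B
    by (simp add: of_int_hom.hom_det flip: map_mat_append_rows of_int_power)
  ultimately have "?h\<^sup>2 * det (gram_mat ?D) = (det T)\<^sup>2 * det (gram_mat A)"
    using det_gram_orthogonal_complement[OF C' P' B' T S TS orthogonal' det_D] by (simp add: A_def)
  then have "sqrt (?h\<^sup>2 * det (gram_mat ?D)) = sqrt ((det T)\<^sup>2 * det (gram_mat A))"
    by simp
  then have "\<bar>?h\<bar> * sqrt (det (gram_mat ?D)) = \<bar>det T\<bar> * sqrt (det (gram_mat A))"
    by (simp add: real_sqrt_mult)
  then show ?thesis
    using lattice_det_eq[OF basis] det_mult_transpose_ne_0
    by (simp add: mat_of_rows_rows_carrier[OF D] field_simps)
qed

end

subsection \<open>Geometric progressions\<close>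

lemma proportional_rows_factorization:
  fixes C :: "'a :: comm_ring_1 mat"
  assumes C: "C \<in> carrier_mat (Suc k) n"
    and proportional: "\<And>i j. i < Suc k \<Longrightarrow> j < n \<Longrightarrow> q dvd C $$ (i, j) - a i * C $$ (0, j)"
  obtains F D where "F \<in> carrier_mat (Suc k) (Suc k)" "D \<in> carrier_mat (Suc k) n"
    "C = F * D" "det F = q ^ k"
proof -
  let ?k = "Suc k"
  obtain b where b: "\<And>i j. i < ?k \<Longrightarrow> j < n \<Longrightarrow> C $$ (i, j) - a i * C $$ (0, j) = q * b i j"
    using proportional unfolding dvd_def by metis
  define F where
    "F = mat ?k ?k (\<lambda>(i, j). if j = 0 then if i = 0 then 1 else a i else if i = j then q else 0)"
  define D where "D = mat ?k n (\<lambda>(i, j). if i = 0 then C $$ (0, j) else b i j)"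
  have F: "F \<in> carrier_mat ?k ?k" and D: "D \<in> carrier_mat ?k n"
    by (simp_all add: F_def D_def)
  have row_F: "row F i =
      (if i = 0 then unit_vec ?k 0 else a i \<cdot>\<^sub>v unit_vec ?k 0 + q \<cdot>\<^sub>v unit_vec ?k i)"
    if "i < ?k" for i
    using that by (intro eq_vecI) (auto simp: F_def)
  have "C = F * D"
  proof (rule eq_matI)
    fix i j assume "i < dim_row (F * D)" "j < dim_col (F * D)"
    then have i: "i < ?k" and j: "j < n"
      using F D by auto
    have "(F * D) $$ (i, j) = row F i \<bullet> col D j"
      using F D i j by simp
    also have "\<dots> = C $$ (i, j)"
      using D i j b[OF i j] unfolding row_F[OF i]
      by (auto simp: add_scalar_prod_distrib[of _ ?k] D_def algebra_simps)
    finally show "C $$ (i, j) = (F * D) $$ (i, j)" ..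
  qed (use C F D in auto)
  moreover have "det F = q ^ k"
  proof -
    have "det F = (\<Prod>i<?k. F $$ (i, i))"
      using det_lower_triangular[OF _ F] F by (simp add: prod_list_diag_prod atLeast0LessThan F_def)
    also have "\<dots> = q ^ k"
      unfolding prod.lessThan_Suc_shift by (simp add: F_def)
    finally show ?thesis .
  qed
  ultimately show thesis
    using that F D by blast
qed

lemma power_dvd_det_mult_proportional_rows:
  fixes C :: "'a :: comm_ring_1 mat"
  assumes C: "C \<in> carrier_mat (Suc k) n" and X: "X \<in> carrier_mat n (Suc k)"
    and "\<And>i j. i < Suc k \<Longrightarrow> j < n \<Longrightarrow> q dvd C $$ (i, j) - a i * C $$ (0, j)"
  shows "q ^ k dvd det (C * X)"
proof -
  obtain F D where F: "F \<in> carrier_mat (Suc k) (Suc k)" and D: "D \<in> carrier_mat (Suc k) n"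
    and C_eq: "C = F * D" and det_F: "det F = q ^ k"
    using proportional_rows_factorization[OF C assms(3)] by metis
  have "C * X = F * (D * X)"
    unfolding C_eq by (rule assoc_mult_mat[OF F D X])
  then show ?thesis
    using det_mult[OF F mult_carrier_mat[OF D X]] det_F by simp
qed

lemma geometric_progression_proportional:
  assumes c: "geometric_progression N r l c" and c': "geometric_progression N r l c'"
    and coprime: "coprime (c $ 0) (int N)"
  shows "\<exists>a. \<forall>j<l. int N dvd c' $ j - a * c $ j"
proof -
  obtain e where e: "[c $ 0 * e = 1] (mod int N)"
    using cong_solve_coprime_int[OF coprime] by blast
  have "[c' $ 0 * e * c $ j = c' $ j] (mod int N)" if j: "j < l" for j
  proof -
    have "[c' $ 0 * e * c $ j = c' $ 0 * e * (c $ 0 * r ^ j)] (mod int N)"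
      using c j by (intro cong_scalar_left) (simp add: geometric_progression_def)
    also have "c' $ 0 * e * (c $ 0 * r ^ j) = (c $ 0 * e) * (c' $ 0 * r ^ j)"
      by simp
    also have "[\<dots> = 1 * (c' $ 0 * r ^ j)] (mod int N)"
      by (rule cong_scalar_right[OF e])
    also have "[1 * (c' $ 0 * r ^ j) = c' $ j] (mod int N)"
      using c' j by (simp add: geometric_progression_def cong_sym_eq)
    finally show ?thesis .
  qed
  then have "\<forall>j<l. int N dvd c' $ j - (c' $ 0 * e) * c $ j"
    by (simp add: cong_iff_dvd_diff dvd_diff_commute)
  then show ?thesis ..
qed

lemma power_dvd_det_geometric_progressions:
  assumes C: "C \<in> carrier_mat (Suc k) n" and X: "X \<in> carrier_mat n (Suc k)"
    and progressions: "\<And>i. i < Suc k \<Longrightarrow> geometric_progression N r n (row C i)"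
    and coprime: "coprime (row C 0 $ 0) (int N)"
  shows "int N ^ k dvd det (C * X)"
proof -
  have "\<exists>a. \<forall>j<n. int N dvd row C i $ j - a * row C 0 $ j" if "i < Suc k" for i
    using that
    by (intro geometric_progression_proportional[OF progressions progressions coprime]) auto
  then obtain a where "\<And>i j. i < Suc k \<Longrightarrow> j < n \<Longrightarrow> int N dvd row C i $ j - a i * row C 0 $ j"
    by metis
  then show ?thesis
    using C by (intro power_dvd_det_mult_proportional_rows[OF C X, of _ a]) auto
qed

lemma power_le_abs_det_geometric_progressions:
  assumes "C \<in> carrier_mat (Suc k) n" "X \<in> carrier_mat n (Suc k)"
    and "\<And>i. i < Suc k \<Longrightarrow> geometric_progression N r n (row C i)"
    and "coprime (row C 0 $ 0) (int N)"
    and "det (C * X) \<noteq> 0"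
  shows "real N ^ k \<le> \<bar>real_of_int (det (C * X))\<bar>"
proof -
  have "int N ^ k \<le> \<bar>det (C * X)\<bar>"
    using power_dvd_det_geometric_progressions[OF assms(1-4)] assms(5) by (intro zdvd_imp_le) auto
  then show ?thesis
    by (metis of_int_abs of_int_le_iff of_int_of_nat_eq of_int_power)
qed

subsection \<open>The determinant bound\<close>

abbreviation (input) power_diag :: "nat \<Rightarrow> real \<Rightarrow> real mat" where
  "power_diag n s \<equiv> mat_diag n (\<lambda>i. s ^ i)"

lemma norm2_nonneg: "0 \<le> norm2 t x"
  unfolding norm2_def by (simp add: sum_nonneg)

lemma norm2_inverse_row:
  assumes M: "M \<in> carrier_mat k (d + 1)" and i: "i < k" and s: "s > 0"
  defines "Y \<equiv> M * power_diag (d + 1) (inverse s)"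
  shows "norm2 (inverse s) (row M i) = s powr (real d / 2) * sqrt (row Y i \<bullet> row Y i)"
proof -
  have Y_eq: "Y = mat k (d + 1) (\<lambda>(i, j). M $$ (i, j) * inverse s ^ j)"
    unfolding Y_def by (rule mat_diag_mult_right[OF M])
  have "row Y i \<bullet> row Y i = (\<Sum>j<d + 1. (row M i $ j * inverse s ^ j)\<^sup>2)"
    using M i unfolding Y_eq
    by (auto simp: scalar_prod_def power2_eq_square atLeast0LessThan intro!: sum.cong)
  moreover have "inverse s powr (- real d / 2) = s powr (real d / 2)"
    using s by (simp add: powr_def ln_inverse)
  ultimately show ?thesis
    using M i unfolding norm2_def by simp
qed

lemma sqrt_det_gram_le_prod_norm2:
  assumes M: "M \<in> carrier_mat k (d + 1)" and s: "s > 0"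
  defines "Y \<equiv> M * power_diag (d + 1) (inverse s)"
  shows "s powr (real d * real k / 2) * sqrt (det (gram_mat Y)) \<le>
    (\<Prod>i<k. norm2 (inverse s) (row M i))"
proof -
  have power: "s powr (real d * real k / 2) = (\<Prod>i<k. s powr (real d / 2))"
    using s by (simp add: powr_powr mult.commute flip: powr_realpow)
  have "Y \<in> carrier_mat k (d + 1)"
    unfolding Y_def by (rule mult_carrier_mat[OF M mat_diag_dim])
  then have "sqrt (det (gram_mat Y)) \<le> sqrt (\<Prod>i<k. row Y i \<bullet> row Y i)"
    by (intro real_sqrt_le_mono hadamard_inequality)
  also have "\<dots> = (\<Prod>i<k. sqrt (row Y i \<bullet> row Y i))"
    by (induction k) (simp_all add: real_sqrt_mult)
  finally have "s powr (real d * real k / 2) * sqrt (det (gram_mat Y)) \<le>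
      s powr (real d * real k / 2) * (\<Prod>i<k. sqrt (row Y i \<bullet> row Y i))"
    by (rule mult_left_mono) simp
  also have "\<dots> = (\<Prod>i<k. norm2 (inverse s) (row M i))"
    unfolding power prod.distrib[symmetric]
    using norm2_inverse_row[OF M _ s] by (intro prod.cong) (simp_all add: Y_def)
  finally show ?thesis .
qed

lemma det_power_diag:
  assumes "s > (0 :: real)"
  shows "det (power_diag (d + 1) s) = s powr (real d * (real d + 1) / 2)"
proof -
  have "det (power_diag (d + 1) s) = s ^ (\<Sum>i<d + 1. i)"
    unfolding det_mat_diag power_sum ..
  also have "\<dots> = s powr real (\<Sum>i<d + 1. i)"
    using assms by (rule powr_realpow[symmetric])
  also have "real (\<Sum>i<d + 1. i) = real d * (real d + 1) / 2"
    by (induction d) (auto simp: field_simps)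
  finally show ?thesis .
qed

text \<open>Of the power \<open>s powr (d (d + 1) / 2) = det (diag(1, s, \<dots>, s\<^sup>d))\<close> the norms absorb
  \<open>s powr (d k / 2)\<close>, which leaves \<open>s powr (d l / 2)\<close> because \<open>d + 1 = k + l\<close>.\<close>

lemma (in orthogonal_completion) transformed_perp_power_diag:
  assumes dim: "k + l = d + 1" and s: "s > 0"
  defines "\<Lambda> \<equiv> transformed_perp (d + 1) (power_diag (d + 1) s) C"
  shows "lattice_of_dim (d + 1) l \<Lambda>"
    and "lattice_det (d + 1) \<Lambda> \<le> s powr (real d * real l / 2) *
      (\<Prod>i<k. norm2 (inverse s) (map_vec real_of_int (row C i))) /
      \<bar>real_of_int (det (C * P\<^sup>T))\<bar>"
proof -
  let ?S = "power_diag (d + 1) s" and ?T = "power_diag (d + 1) (inverse s)"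
  let ?C = "map_mat real_of_int C" and ?h = "real_of_int (det (C * P\<^sup>T))"
  have ST: "?S * ?T = 1\<^sub>m (d + 1)"
    using s by (simp add: power_inverse flip: mat_diag_one)
  have det_S: "det ?S = s powr (real d * (real d + 1) / 2)"
    by (rule det_power_diag[OF s])
  show "lattice_of_dim (d + 1) l \<Lambda>"
    using lattice_of_dim_transform_perp[of ?S] s det_S unfolding \<Lambda>_def dim by simp
  have T_sym: "?T\<^sup>T = ?T"
    by (rule eq_matI) (auto simp: mat_diag_def)
  have "real d + 1 = real k + real l"
    using dim by linarith
  then have exponent: "real d * (real d + 1) / 2 = real d * real l / 2 + real d * real k / 2"
    by (simp add: field_simps)
  have "row ?C i = map_vec real_of_int (row C i)" if "i < k" for i
    using that C by auto
  then have norms: "(\<Prod>i<k. norm2 (inverse s) (row ?C i)) =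
      (\<Prod>i<k. norm2 (inverse s) (map_vec real_of_int (row C i)))"
    by (intro prod.cong) auto
  have "lattice_det (d + 1) \<Lambda> = det ?S * sqrt (det (gram_mat (?C * ?T))) / \<bar>?h\<bar>"
    using lattice_det_transform_perp[of ?S ?T] ST det_S T_sym unfolding \<Lambda>_def dim by simp
  also have "\<dots> = s powr (real d * real l / 2) *
      (s powr (real d * real k / 2) * sqrt (det (gram_mat (?C * ?T)))) / \<bar>?h\<bar>"
    unfolding det_S exponent powr_add by simp
  also have "\<dots> \<le> s powr (real d * real l / 2) * (\<Prod>i<k. norm2 (inverse s) (row ?C i)) / \<bar>?h\<bar>"
    using C dim
    by (intro divide_right_mono mult_left_mono sqrt_det_gram_le_prod_norm2[OF _ s]) simp_all
  finally show "lattice_det (d + 1) \<Lambda> \<le> s powr (real d * real l / 2) *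
      (\<Prod>i<k. norm2 (inverse s) (map_vec real_of_int (row C i))) / \<bar>?h\<bar>"
    unfolding norms .
qed

lemma geometric_progressions_lattice_perp:
  fixes C :: "int mat"
  assumes C: "C \<in> carrier_mat k (d + 1)" and k: "1 \<le> k" "k \<le> d" and N: "N > 0" and s: "s > 0"
    and progressions: "\<And>i. i < k \<Longrightarrow> geometric_progression N m (d + 1) (row C i)"
    and independent: "lin_indpt_list (d + 1) (rows C)"
    and coprime: "coprime (row C 0 $ 0) (int N)"
  defines "\<Lambda> \<equiv> transformed_perp (d + 1) (power_diag (d + 1) s) C"
  shows "lattice_of_dim (d + 1) (d - k + 1) \<Lambda>"
    and "lattice_det (d + 1) \<Lambda> \<le> s powr (real d * (real d - real k + 1) / 2) *
      (\<Prod>i<k. norm2 (inverse s) (map_vec real_of_int (row C i))) / real N ^ (k - 1)"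
proof -
  have dim: "k + (d - k + 1) = d + 1"
    using k by simp
  have codim: "real (d - k + 1) = real d - real k + 1"
    using k by simp
  obtain P B where "orthogonal_completion k (d - k + 1) C P B"
    using orthogonal_completion_exists[of C k "d - k + 1"] C independent unfolding dim by blast
  then interpret completion: orthogonal_completion k "d - k + 1" C P B .
  show "lattice_of_dim (d + 1) (d - k + 1) \<Lambda>"
    unfolding \<Lambda>_def by (rule completion.transformed_perp_power_diag(1)[OF dim s])
  let ?norms = "\<Prod>i<k. norm2 (inverse s) (map_vec real_of_int (row C i))"
  have "P\<^sup>T \<in> carrier_mat (d + 1) k"
    using completion.transpose_carriers(2) unfolding dim .
  then have bound: "real N ^ (k - 1) \<le> \<bar>real_of_int (det (C * P\<^sup>T))\<bar>"
    using C progressions coprime k completion.det_mult_transpose_ne_0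
    by (intro power_le_abs_det_geometric_progressions[of _ _ "d + 1" _ _ m]) auto
  have "lattice_det (d + 1) \<Lambda> \<le> s powr (real d * (real d - real k + 1) / 2) * ?norms /
      \<bar>real_of_int (det (C * P\<^sup>T))\<bar>"
    using completion.transformed_perp_power_diag(2)[OF dim s] unfolding \<Lambda>_def codim .
  also have "\<dots> \<le> s powr (real d * (real d - real k + 1) / 2) * ?norms / real N ^ (k - 1)"
    using bound N completion.det_mult_transpose_ne_0
    by (intro divide_left_mono mult_nonneg_nonneg prod_nonneg)
      (auto simp: norm2_nonneg zero_less_mult_iff)
  finally show "lattice_det (d + 1) \<Lambda> \<le>
      s powr (real d * (real d - real k + 1) / 2) * ?norms / real N ^ (k - 1)" .
qed

theorem theorem3p4:
  fixes N d k :: nat and m :: int and c :: "nat \<Rightarrow> int vec" and L :: "int vec set"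
    and s :: real and S :: "real mat"
  assumes "N > 0" and "1 \<le> k" and "k \<le> d"
    and "\<And>i. i \<in> {1..k} \<Longrightarrow> geometric_progression N m (d + 1) (c i)"
    and "lin_indpt_list (d + 1) (map c [1..<k + 1])"
    and "gcd (c 1 $ 0) (int N) = 1"
    and "lattice_basis (d + 1) (map c [1..<k + 1]) L"
    and "s > 0"
    and "S = mat_diag (d + 1) (\<lambda>i. s ^ i)"
  shows "lattice_of_dim (d + 1) (d - k + 1) (lattice_transform S (lattice_perp (d + 1) L)) \<and>
    lattice_det (d + 1) (lattice_transform S (lattice_perp (d + 1) L))
      \<le> s powr (real d * (real d - real k + 1) / 2) * real N powi (1 - int k)
        * (\<Prod>i = 1..k. norm2 (inverse s) (map_vec real_of_int (c i)))"
proof -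
  define C where "C = mat_of_rows (d + 1) (map c [1..<k + 1])"
  have C: "C \<in> carrier_mat k (d + 1)"
    unfolding C_def by (intro carrier_matI) simp_all
  have rows: "rows C = map c [1..<k + 1]"
    using assms(5) unfolding C_def lin_indpt_list_def by (intro rows_mat_of_rows) simp
  have row: "row C i = c (i + 1)" if "i < k" for i
    using arg_cong[OF rows, of "\<lambda>cs. cs ! i"] that C by (simp del: upt_Suc)
  have L: "L = row_lattice (d + 1) C"
    using assms(7) by (simp add: rows lattice_basis_def)
  have "real N powi (1 - int k) = 1 / real N ^ (k - 1)"
    using assms(2) by (simp add: power_int_def nat_diff_distrib power_inverse divide_inverse)
  moreover have "(\<Prod>i = 1..k. norm2 (inverse s) (map_vec real_of_int (c i))) =
      (\<Prod>i<k. norm2 (inverse s) (map_vec real_of_int (row C i)))"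
    by (rule prod.reindex_bij_witness[of _ "\<lambda>i. i + 1" "\<lambda>i. i - 1"]) (auto simp: row)
  ultimately show ?thesis
    using geometric_progressions_lattice_perp[OF C assms(2,3,1,8), of m] assms(2-6,9)
    by (simp add: L row rows coprime_iff_gcd_eq_1)
qed

end
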